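(* Let $H$ be a real Hilbert space (of functions) with norm $\|\cdot\|$, let $a(\cdot,\cdot)$ be a symmetric $H$-elliptic bilinear form on $H$, $b$ a continuous linear functional on $H$, and $\Psi(u)=\frac12a(u,u)-b(u)$. Let $\|v\|_E=\sqrt{a(v,v)}$ be the energy norm, and let $c_1,c_2>0$ be such that $c_1\|v\|\le\|v\|_E\le c_2\|v\|$ for all $v\in H$. Let $F(\cdot;\alpha):H\to H$, $\alpha\in\mathbb{R}^M$, be a family of Read-Bajactarević (RB) operators such that $F(u;\alpha)$ is a linear function of $(u,\alpha)\in H\times\mathbb{R}^M$ (so that $F(u;\alpha)=F(u;0)+F(0;\alpha)$), and which is contractive with constant $c\in(0,1)$, i.e. $\|F(u;\alpha)-F(v;\alpha)\|\le c\|u-v\|$ for all $u,v\in H$ and $\alpha\in\mathbb{R}^M$, where $c<c_1/c_2$. Let $W:=\{F(0;\alpha)\mid\alpha\in\mathbb{R}^M\}$, $W(u):=F(u;0)+W$, $G(u):=\operatorname{argmin}_{w\in W(u)}\Psi(w)$ for $u\in H$, and $$V_N:=\{u_\alpha\mid\alpha\in\mathbb{R}^M,\ u_\alpha=F(u_\alpha;\alpha)\},$$ the set of fixed points of the operators $F(\cdot;\alpha)$. Then there exists a unique $\tilde u_N\in V_N$ such that $\tilde u_N=G(\tilde u_N)$.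
   Context: $H$-elliptic means that the bilinear form $a$ is continuous and coercive on $H$, so that the energy norm is equivalent to the norm of $H$. RB operators: the elements of $H$ are real-valued functions (or classes of functions) on a set $\mathbb{X}$. Given subsets $\mathbb{X}_1,\dots,\mathbb{X}_N\subseteq\mathbb{X}$ and injective maps $u_i:\mathbb{X}_i\to\mathbb{X}$ whose images $u_i(\mathbb{X}_i)$ partition $\mathbb{X}$, and maps $v_i:\mathbb{X}_i\times\mathbb{R}\to\mathbb{R}$, the associated RB operator sends $f$ to the function equal to $v_i(u_i^{-1}(x),f(u_i^{-1}(x)))$ for $x\in u_i(\mathbb{X}_i)$, $i=1,\dots,N$. Here $F(\cdot;\alpha)$ is a family of such operators mapping $H$ to $H$, depending on a parameter vector $\alpha\in\mathbb{R}^M$. The element $\tilde u_N$ is called the collage fit. *)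

theory Defs
  imports "HOL-Analysis.Analysis"
begin

text \<open>
  A Hilbert space whose elements are real-valued functions, or classes of functions, on a set
  \<open>X\<close> is given by a linear space \<open>L\<close> of representing functions and the linear surjection
  \<open>cls\<close> sending a function to the element of the Hilbert space it represents. In a space of
  functions \<open>cls\<close> identifies only functions that agree on \<open>X\<close>; in a space such as \<open>L\<^sup>2\<close> it also
  identifies functions that are equal almost everywhere. The values of a function outside
  \<open>X\<close> are irrelevant, which is the purpose of the first condition.
\<close>

definition function_space_on ::
    "'x set \<Rightarrow> ('x \<Rightarrow> real) set \<Rightarrow> (('x \<Rightarrow> real) \<Rightarrow> 'h::real_vector) \<Rightarrow> bool" where
  "function_space_on X L cls \<longleftrightarrow>
     (\<forall>f\<in>L. \<forall>g. (\<forall>x\<in>X. g x = f x) \<longrightarrow> g \<in> L \<and> cls g = cls f) \<and>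
     (\<lambda>x. 0) \<in> L \<and>
     (\<forall>f\<in>L. \<forall>g\<in>L. (\<lambda>x. f x + g x) \<in> L \<and> cls (\<lambda>x. f x + g x) = cls f + cls g) \<and>
     (\<forall>r. \<forall>f\<in>L. (\<lambda>x. r * f x) \<in> L \<and> cls (\<lambda>x. r * f x) = r *\<^sub>R cls f) \<and>
     cls ` L = UNIV"

definition RB_data ::
    "'x set \<Rightarrow> nat \<Rightarrow> (nat \<Rightarrow> 'x set) \<Rightarrow> (nat \<Rightarrow> 'x \<Rightarrow> 'x) \<Rightarrow> bool" where
  "RB_data X N Xs u \<longleftrightarrow>
     (\<forall>i\<in>{1..N}. Xs i \<subseteq> X \<and> inj_on (u i) (Xs i)) \<and>
     disjoint_family_on (\<lambda>i. u i ` Xs i) {1..N} \<and>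
     (\<Union>i\<in>{1..N}. u i ` Xs i) = X"

text \<open>
  Under \<open>RB_data X N Xs u\<close> the index chosen below exists and is unique for every \<open>x \<in> X\<close>.
\<close>

definition RB_map ::
    "nat \<Rightarrow> (nat \<Rightarrow> 'x set) \<Rightarrow> (nat \<Rightarrow> 'x \<Rightarrow> 'x) \<Rightarrow> (nat \<Rightarrow> 'x \<times> real \<Rightarrow> real)
      \<Rightarrow> ('x \<Rightarrow> real) \<Rightarrow> 'x \<Rightarrow> real" where
  "RB_map N Xs u v f x =
     (let i = (THE i. i \<in> {1..N} \<and> x \<in> u i ` Xs i);
          y = inv_into (Xs i) (u i) x
      in v i (y, f y))"

text \<open>
  An operator on the Hilbert space is an RB operator if it is induced by some \<open>RB_map\<close>
  acting on representing functions (whichever representative is chosen).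
\<close>

definition RB_operator ::
    "'x set \<Rightarrow> ('x \<Rightarrow> real) set \<Rightarrow> (('x \<Rightarrow> real) \<Rightarrow> 'h) \<Rightarrow> nat \<Rightarrow> ('h \<Rightarrow> 'h) \<Rightarrow> bool" where
  "RB_operator X L cls N T \<longleftrightarrow>
     (\<exists>Xs u v. RB_data X N Xs u \<and>
        (\<forall>f\<in>L. RB_map N Xs u v f \<in> L \<and> T (cls f) = cls (RB_map N Xs u v f)))"

definition elliptic :: "('h::real_normed_vector \<Rightarrow> 'h \<Rightarrow> real) \<Rightarrow> bool" where
  "elliptic a \<longleftrightarrow> bounded_bilinear a \<and> (\<exists>\<gamma>>0. \<forall>v. \<gamma> * (norm v)\<^sup>2 \<le> a v v)"

definition energy_norm :: "('h \<Rightarrow> 'h \<Rightarrow> real) \<Rightarrow> 'h \<Rightarrow> real" where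
  "energy_norm a v = sqrt (a v v)"

definition Psi :: "('h \<Rightarrow> 'h \<Rightarrow> real) \<Rightarrow> ('h \<Rightarrow> real) \<Rightarrow> 'h \<Rightarrow> real" where
  "Psi a b u = 1 / 2 * a u u - b u"

definition W_lin :: "('h::real_vector \<Rightarrow> 'p \<Rightarrow> 'h) \<Rightarrow> 'h set" where
  "W_lin F = {F 0 \<alpha> | \<alpha>. True}"

definition W_aff :: "('h::real_vector \<Rightarrow> 'p::real_vector \<Rightarrow> 'h) \<Rightarrow> 'h \<Rightarrow> 'h set" where
  "W_aff F u = {F u 0 + w | w. w \<in> W_lin F}"

text \<open>
  \<open>arg_min_on\<close> is a choice among minimisers. For an elliptic symmetric form \<open>a\<close>, a bounded
  linear functional \<open>b\<close>, \<open>F\<close> linear in both arguments jointly and a finite-dimensional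
  parameter space, \<open>Psi a b\<close> has exactly one minimiser on the finite-dimensional affine
  subspace \<open>W_aff F u\<close>, so the choice is immaterial.
\<close>

definition G_op ::
    "('h \<Rightarrow> 'h \<Rightarrow> real) \<Rightarrow> ('h \<Rightarrow> real) \<Rightarrow> ('h::real_vector \<Rightarrow> 'p::real_vector \<Rightarrow> 'h) \<Rightarrow> 'h \<Rightarrow> 'h" where
  "G_op a b F u = arg_min_on (Psi a b) (W_aff F u)"

definition V_fix :: "('h \<Rightarrow> 'p \<Rightarrow> 'h) \<Rightarrow> 'h set" where
  "V_fix F = {u. \<exists>\<alpha>. u = F u \<alpha>}"

end

theory Submission
  imports Defs
begin

text \<open>
  A fixed point of \<open>G\<close> lies in \<open>W_aff F u\<close>, so it has the form \<open>u = F u 0 + F 0 \<alpha> = F u \<alpha>\<close> and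
  belongs to \<open>V_fix F\<close> automatically. It remains to see that \<open>G\<close> has exactly one fixed point,
  and this holds because \<open>G\<close> is a contraction for the energy norm, with constant
  \<open>c * c2 / c1 < 1\<close>.

  The minimiser of \<open>Psi\<close> on \<open>F u 0 + W\<close> is characterised by the Galerkin equations
  \<open>a (G u) \<phi> = b \<phi>\<close> for all \<open>\<phi> \<in> W\<close>. They can be solved because \<open>W\<close> is spanned by finitely many
  vectors (\<open>galerkin_solvable\<close>), and completing the square shows that their solution is the strict
  minimiser (\<open>galerkin_solution_is_arg_min_on\<close>). Subtracting the equations for two arguments, the
  difference \<open>d = G u - G v\<close> is \<open>a\<close>-orthogonal to \<open>W\<close>, while \<open>F (u - v) 0 - d\<close> lies in \<open>W\<close>. So \<open>d\<close>
  is the \<open>a\<close>-orthogonal projection of \<open>F (u - v) 0\<close> onto the complement of \<open>W\<close>, and its energy norm is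
  at most that of \<open>F (u - v) 0\<close>. The map \<open>F _ 0\<close>
  contracts by \<open>c\<close> in the norm of the space; passing to that norm and back costs a factor \<open>c2 / c1\<close>.

  Completeness is known for the given norm only, so Banach's theorem is applied to a high iterate
  of \<open>G\<close>, which is a contraction in that norm as well
  (\<open>equivalent_norm_contraction_unique_fixed_point\<close>).
\<close>

text \<open>
  By Gram-Schmidt orthogonalisation with respect to \<open>a\<close>: a new spanning vector \<open>e\<close> is replaced
  by its component \<open>q\<close> orthogonal to the old ones, and adding a multiple of \<open>q\<close> to the old solution
  adjusts the equation for \<open>e\<close> without disturbing the others.
\<close>

lemma galerkin_solvable:
  fixes a :: "'v::real_vector \<Rightarrow> 'v \<Rightarrow> real"
  assumes "finite B" and bil: "bilinear a" and pos: "\<And>v. v \<noteq> 0 \<Longrightarrow> 0 < a v v"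
    and "linear l"
  shows "\<exists>w\<in>span B. \<forall>\<phi>\<in>span B. a w \<phi> = l \<phi>"
proof -
  have lin: "linear (a x)" for x
    using bil by (auto simp: bilinear_def)
  have "\<exists>w\<in>span B. \<forall>\<phi>\<in>B. a w \<phi> = l \<phi>"
    using \<open>finite B\<close> \<open>linear l\<close>
  proof (induction B arbitrary: l rule: finite_induct)
    case empty
    then show ?case by auto
  next
    case (insert e B)
    obtain w where w: "w \<in> span B" "\<And>\<phi>. \<phi> \<in> B \<Longrightarrow> a w \<phi> = l \<phi>"
      using insert.IH[OF insert.prems] by blast
    obtain p where p: "p \<in> span B" "\<And>\<phi>. \<phi> \<in> B \<Longrightarrow> a p \<phi> = a e \<phi>"
      using insert.IH[OF lin[of e]] by blast
    define q where "q = e - p"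
    have q_orth: "a q \<phi> = 0" if "\<phi> \<in> span B" for \<phi>
      using linear_eq_on[OF lin[of q] module_hom_zero that] p(2)
      by (simp add: q_def bilinear_lsub[OF bil])
    have w_span: "a w \<phi> = l \<phi>" if "\<phi> \<in> span B" for \<phi>
      using linear_eq_on[OF lin insert.prems that] w(2) by blast
    have sub: "span B \<subseteq> span (insert e B)"
      by (rule span_mono) auto
    show ?case
    proof (cases "q = 0")
      case True
      then have "e \<in> span B"
        using p(1) by (simp add: q_def)
      then show ?thesis
        using w_span w sub by auto
    next
      case False
      have "a q e = a q q"
        using q_orth[OF p(1)] bilinear_radd[OF bil, of q q p] by (simp add: q_def)
      with pos[OF False] have qe: "a q e \<noteq> 0"
        by simp
      define t where "t = (l e - a w e) / a q e"
      have a_new: "a (w + t *\<^sub>R q) \<phi> = a w \<phi> + t * a q \<phi>" for \<phi>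
        by (simp add: bilinear_ladd[OF bil] bilinear_lmul[OF bil])
      have "e \<in> span (insert e B)"
        by (simp add: span_base)
      then have "w + t *\<^sub>R q \<in> span (insert e B)"
        unfolding q_def using w(1) p(1) sub
        by (intro span_add span_scale span_diff) auto
      moreover have "a (w + t *\<^sub>R q) \<phi> = l \<phi>" if "\<phi> \<in> insert e B" for \<phi>
        using that qe by (auto simp: a_new w(2) q_orth span_base) (simp add: t_def)
      ultimately show ?thesis
        by blast
    qed
  qed
  then show ?thesis
    using linear_eq_on[OF lin \<open>linear l\<close>] by blast
qed

text \<open>
  Completing the square: moving from the Galerkin solution \<open>g\<close> by \<open>w - g\<close> raises \<open>Psi\<close> by exactly
  \<open>1 / 2 * a (w - g) (w - g)\<close>. The minimum is therefore strict, which makes the arbitrary choice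
  in \<open>arg_min_on\<close> harmless.
\<close>

lemma galerkin_solution_is_arg_min_on:
  fixes a :: "'v::real_vector \<Rightarrow> 'v \<Rightarrow> real"
  assumes bil: "bilinear a" and sym: "\<And>u v. a u v = a v u"
    and pos: "\<And>v. v \<noteq> 0 \<Longrightarrow> 0 < a v v"
    and "linear b" and "g \<in> S" and gal: "\<And>w. w \<in> S \<Longrightarrow> a g (w - g) = b (w - g)"
  shows "arg_min_on (Psi a b) S = g"
proof -
  have strict: "Psi a b g < Psi a b w" if "w \<in> S" "w \<noteq> g" for w
  proof -
    have "Psi a b w - Psi a b g = 1 / 2 * a (w - g) (w - g) + (a g (w - g) - b (w - g))"
      using sym[of w g]
      by (simp add: Psi_def bilinear_lsub[OF bil] bilinear_rsub[OF bil] linear_diff[OF \<open>linear b\<close>])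
        (simp add: field_simps)
    then show ?thesis
      using pos[of "w - g"] gal[OF that(1)] that(2) by simp
  qed
  then have "is_arg_min (Psi a b) (\<lambda>w. w \<in> S) w \<longleftrightarrow> w = g" for w
    using \<open>g \<in> S\<close> by (auto simp: is_arg_min_def) (metis less_asym)+
  then show ?thesis
    by (simp add: arg_min_on_def arg_min_def)
qed

text \<open>
  The factor \<open>C\<close> may exceed \<open>1\<close>, so \<open>T\<close> itself need not be a contraction, but an iterate of high
  order is one. Its unique fixed point \<open>x\<close> is also fixed by \<open>T\<close>,
  since \<open>T x\<close> is another fixed point of the same iterate.
\<close>

lemma eventually_contractive_unique_fixed_point:
  fixes T :: "'v::complete_space \<Rightarrow> 'v"
  assumes "0 \<le> q" "q < 1"
    and contr: "\<And>n x y. dist ((T ^^ n) x) ((T ^^ n) y) \<le> C * q ^ n * dist x y"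
  shows "\<exists>!x. T x = x"
proof -
  have "(\<lambda>n. C * q ^ n) \<longlonglongrightarrow> C * 0"
    using assms by (intro tendsto_mult_left LIMSEQ_power_zero) auto
  then have "\<forall>\<^sub>F n in sequentially. C * q ^ n < 1 / 2"
    by (rule order_tendstoD) simp
  then obtain n where n: "C * q ^ n < 1 / 2"
    by (auto simp: eventually_sequentially)
  have "dist ((T ^^ n) x) ((T ^^ n) y) \<le> 1 / 2 * dist x y" for x y
    using contr[of n x y] mult_right_mono[OF less_imp_le[OF n] zero_le_dist[of x y]] by linarith
  then have "\<exists>!x. (T ^^ n) x = x"
    using banach_fix_type[of "1 / 2" "T ^^ n"] by simp
  then obtain x where x: "(T ^^ n) x = x" "\<And>y. (T ^^ n) y = y \<Longrightarrow> y = x"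
    by auto
  have "(T ^^ n) (T x) = T x"
    by (metis funpow_swap1 x(1))
  then have "T x = x"
    using x(2) by blast
  moreover have "(T ^^ n) y = y" if "T y = y" for y
    using that by (induction n) auto
  ultimately show ?thesis
    using x(2) by blast
qed

text \<open>
  Only the iterates are compared in the given norm, so the price \<open>c2 / c1\<close> of changing norms is paid
  once and does not accumulate.
\<close>

lemma equivalent_norm_contraction_unique_fixed_point:
  fixes T :: "'v::{real_normed_vector, complete_space} \<Rightarrow> 'v"
  assumes "0 < c1" and equiv: "\<And>v. c1 * norm v \<le> E v \<and> E v \<le> c2 * norm v"
    and "0 \<le> q" "q < 1" and contr: "\<And>x y. E (T x - T y) \<le> q * E (x - y)"
  shows "\<exists>!x. T x = x"
proof (rule eventually_contractive_unique_fixed_point[OF \<open>0 \<le> q\<close> \<open>q < 1\<close>])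
  fix n x y
  have "E ((T ^^ n) x - (T ^^ n) y) \<le> q ^ n * E (x - y)"
  proof (induction n)
    case (Suc n)
    then show ?case
      using contr[of "(T ^^ n) x" "(T ^^ n) y"] mult_left_mono[OF Suc \<open>0 \<le> q\<close>]
      by (simp add: mult.assoc)
  qed simp
  also have "\<dots> \<le> q ^ n * (c2 * norm (x - y))"
    using equiv \<open>0 \<le> q\<close> by (intro mult_left_mono) auto
  finally have "c1 * norm ((T ^^ n) x - (T ^^ n) y) \<le> q ^ n * (c2 * norm (x - y))"
    using equiv order_trans by blast
  then show "dist ((T ^^ n) x) ((T ^^ n) y) \<le> c2 / c1 * q ^ n * dist x y"
    using \<open>0 < c1\<close> by (simp add: dist_norm field_simps)
qed

theorem corollary6p2:
  fixes X :: "'x set"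
    and L :: "('x \<Rightarrow> real) set"
    and cls :: "('x \<Rightarrow> real) \<Rightarrow> 'h::{real_inner, complete_space}"
    and N :: nat
    and a :: "'h \<Rightarrow> 'h \<Rightarrow> real"
    and b :: "'h \<Rightarrow> real"
    and F :: "'h \<Rightarrow> real ^ 'm \<Rightarrow> 'h"
    and c c1 c2 :: real
  assumes H_functions: "function_space_on X L cls"
    and a_sym: "\<And>u v. a u v = a v u"
    and a_elliptic: "elliptic a"
    and b_cont: "bounded_linear b"
    and c1_pos: "0 < c1"
    and c2_pos: "0 < c2"
    and norm_equiv: "\<And>v. c1 * norm v \<le> energy_norm a v \<and> energy_norm a v \<le> c2 * norm v"
    and F_RB: "\<And>\<alpha>. RB_operator X L cls N (\<lambda>u. F u \<alpha>)"
    and F_linear: "linear (\<lambda>(u, \<alpha>). F u \<alpha>)"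
    and c_range: "0 < c" "c < 1"
    and F_contractive: "\<And>u v \<alpha>. norm (F u \<alpha> - F v \<alpha>) \<le> c * norm (u - v)"
    and c_small: "c < c1 / c2"
  shows "\<exists>!u. u \<in> V_fix F \<and> u = G_op a b F u"
proof -
  have "bounded_bilinear a"
    using a_elliptic by (simp add: elliptic_def)
  then have bil: "bilinear a"
    using bounded_bilinear.bounded_linear_left[of a] bounded_bilinear.bounded_linear_right[of a]
    by (simp add: bilinear_def bounded_linear.linear)
  obtain \<gamma> where \<gamma>: "\<gamma> > 0" "\<And>v. \<gamma> * (norm v)\<^sup>2 \<le> a v v"
    using a_elliptic by (auto simp: elliptic_def)
  have pos: "0 < a v v" if "v \<noteq> 0" for v
  proof -
    have "0 < \<gamma> * (norm v)\<^sup>2"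
      using \<gamma>(1) that by simp
    then show ?thesis
      using \<gamma>(2)[of v] by linarith
  qed
  have nonneg: "0 \<le> a v v" for v
    using \<gamma>(1) \<gamma>(2)[of v] by (meson mult_nonneg_nonneg less_imp_le order_trans zero_le_power2)
  have lin_b: "linear b"
    using b_cont by (rule bounded_linear.linear)

  have F_add: "F (u + v) (\<alpha> + \<beta>) = F u \<alpha> + F v \<beta>" for u v \<alpha> \<beta>
    using linear_add[OF F_linear, of "(u, \<alpha>)" "(v, \<beta>)"] by simp
  have F_scale: "F (r *\<^sub>R u) (r *\<^sub>R \<alpha>) = r *\<^sub>R F u \<alpha>" for r u \<alpha>
    using linear_scale[OF F_linear, of r "(u, \<alpha>)"] by simp
  have F_diff: "F (u - v) 0 = F u 0 - F v 0" for u v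
    using F_add[of "u - v" v 0 0] by simp
  have F00: "F 0 0 = 0"
    using F_diff[of 0 0] by simp
  have "linear (F 0)"
    using F_add[of 0 0] F_scale[of _ 0] by (intro linearI) auto
  then have W_span: "W_lin F = span (F 0 ` Basis)"
    by (auto simp: W_lin_def linear_span_image)

  define G where "G = G_op a b F"
  have galerkin: "G u \<in> W_aff F u \<and> (\<forall>\<phi>\<in>W_lin F. a (G u) \<phi> = b \<phi>)" for u
  proof -
    have "linear (\<lambda>\<phi>. b \<phi> - a (F u 0) \<phi>)"
      using bil lin_b by (auto simp: bilinear_def intro!: linear_compose_sub)
    then obtain w where w: "w \<in> W_lin F" "\<And>\<phi>. \<phi> \<in> W_lin F \<Longrightarrow> a w \<phi> = b \<phi> - a (F u 0) \<phi>"
      using galerkin_solvable[OF finite_imageI[OF finite_Basis] bil pos] unfolding W_span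
      by blast
    let ?g = "F u 0 + w"
    have g: "?g \<in> W_aff F u" "\<And>\<phi>. \<phi> \<in> W_lin F \<Longrightarrow> a ?g \<phi> = b \<phi>"
      using w by (auto simp: W_aff_def bilinear_ladd[OF bil])
    moreover have "v - ?g \<in> W_lin F" if v: "v \<in> W_aff F u" for v
    proof -
      obtain w' where "w' \<in> W_lin F" "v = F u 0 + w'"
        using v unfolding W_aff_def by blast
      then show ?thesis
        using w(1) unfolding W_span by (simp add: span_diff)
    qed
    ultimately have "G u = ?g"
      unfolding G_def G_op_def
      by (intro galerkin_solution_is_arg_min_on[OF bil a_sym pos lin_b]) blast+
    then show ?thesis
      using g by simp
  qed

  have in_V: "u \<in> V_fix F" if "G u = u" for u
  proof -
    have "u \<in> W_aff F u"
      using galerkin[of u] unfolding that by blast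
    then obtain \<alpha> where "u = F u 0 + F 0 \<alpha>"
      unfolding W_aff_def W_lin_def by blast
    also have "\<dots> = F u \<alpha>"
      using F_add[of u 0 0 \<alpha>] by simp
    finally show ?thesis
      unfolding V_fix_def by blast
  qed

  define q where "q = c * c2 / c1"
  have q: "0 \<le> q" "q < 1"
    using c_range c1_pos c2_pos c_small by (auto simp: q_def field_simps)
  have contr: "energy_norm a (G u - G v) \<le> q * energy_norm a (u - v)" for u v
  proof -
    define d z where "d = G u - G v" and "z = F (u - v) 0"
    obtain w w' where "w \<in> W_lin F" "w' \<in> W_lin F" "G u = F u 0 + w" "G v = F v 0 + w'"
      using galerkin[of u] galerkin[of v] by (auto simp: W_aff_def)
    then have "z - d = w' - w" "w' - w \<in> W_lin F"
      unfolding d_def z_def F_diff W_span by (simp_all add: span_diff)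
    then have orth: "a d (z - d) = 0"
      using galerkin[of u] galerkin[of v] by (simp add: d_def bilinear_lsub[OF bil])
    \<comment> \<open>Pythagoras for the orthogonal decomposition \<open>z = d + (z - d)\<close>\<close>
    have "a z z = a d d + a (z - d) (z - d)"
      using orth a_sym[of d z] by (simp add: bilinear_lsub[OF bil] bilinear_rsub[OF bil])
    then have "energy_norm a d \<le> energy_norm a z"
      using nonneg[of "z - d"] by (simp add: energy_norm_def)
    also have "\<dots> \<le> c2 * norm z"
      using norm_equiv by blast
    also have "\<dots> \<le> c2 * (c * norm (u - v))"
      using F_contractive[of "u - v" 0 0] c2_pos by (simp add: z_def F00)
    also have "\<dots> = q * (c1 * norm (u - v))"
      using c1_pos by (simp add: q_def)
    also have "\<dots> \<le> q * energy_norm a (u - v)"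
      using norm_equiv q(1) by (intro mult_left_mono) auto
    finally show ?thesis
      by (simp add: d_def)
  qed

  have "\<exists>!u. G u = u"
    by (rule equivalent_norm_contraction_unique_fixed_point[OF c1_pos norm_equiv q contr])
  moreover have "u \<in> V_fix F \<and> u = G_op a b F u \<longleftrightarrow> G u = u" for u
    using in_V[of u] unfolding G_def by metis
  ultimately show ?thesis
    by simp
qed

end
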